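(* Let $r\ge1$ and $p\ge3$ be integers, and let $\mathbb P$ be a probability distribution on $\mathbb R^p$ of the form $$\mathbb P=\sum_{i=1}^r\pi_i\prod_{j=1}^p\mu_i^j,$$ where $\pi_i>0$, $\sum_{i=1}^r\pi_i=1$, and each $\mu_i^j$ is a probability measure on $\mathbb R$ (the product denoting the product measure). Suppose that for every $j\in\{1,\dots,p\}$ the measures $\{\mu_i^j\}_{1\le i\le r}$ are linearly independent. Then the parameters $\{\pi_i,\mu_i^j\}_{1\le i\le r,\,1\le j\le p}$ are strictly identifiable from $\mathbb P$, up to label swapping: if also $\mathbb P=\sum_{i=1}^r\pi_i'\prod_{j=1}^p\nu_i^j$ with $\pi_i'>0$, $\sum_i\pi_i'=1$ and $\nu_i^j$ probability measures on $\mathbb R$, then there is a permutation $\sigma$ of $\{1,\dots,r\}$ such that $\pi_i'=\pi_{\sigma(i)}$ and $\nu_i^j=\mu_{\sigma(i)}^j$ for all $1\le i\le r$, $1\le j\le p$.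
   Context: The number $r$ of mixture components is known. Linear independence of $\{\mu_i^j\}_{1\le i\le r}$ means linear independence over $\mathbb R$ in the vector space of finite signed Borel measures on $\mathbb R$. *)

theory Defs
  imports "HOL-Probability.Probability"
begin

section \<open>Finite signed Borel measures on the real line\<close>

text \<open>
  Set functions are required to vanish outside the Borel sets, so that two signed measures are
  equal iff they agree on Borel sets.
\<close>

typedef signed_measure =
  "{\<nu> :: real set \<Rightarrow> real.
      (\<forall>A. A \<notin> sets borel \<longrightarrow> \<nu> A = 0) \<and> \<nu> {} = 0 \<and>
      (\<forall>A :: nat \<Rightarrow> real set. range A \<subseteq> sets borel \<longrightarrow> disjoint_family A \<longrightarrow>
         (\<lambda>n. \<nu> (A n)) sums \<nu> (\<Union>n. A n))}"
  morphisms sm_apply Abs_signed_measure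
  by (rule exI[of _ "\<lambda>_. 0"]) simp

setup_lifting type_definition_signed_measure

instantiation signed_measure :: real_vector
begin

lift_definition zero_signed_measure :: signed_measure is "\<lambda>_. 0"
  by simp

lift_definition plus_signed_measure :: "signed_measure \<Rightarrow> signed_measure \<Rightarrow> signed_measure"
  is "\<lambda>\<mu> \<nu> A. \<mu> A + \<nu> A"
  by (auto intro: sums_add)

lift_definition minus_signed_measure :: "signed_measure \<Rightarrow> signed_measure \<Rightarrow> signed_measure"
  is "\<lambda>\<mu> \<nu> A. \<mu> A - \<nu> A"
  by (auto intro: sums_diff)

lift_definition uminus_signed_measure :: "signed_measure \<Rightarrow> signed_measure"
  is "\<lambda>\<mu> A. - \<mu> A"
  by (auto intro: sums_minus)

lift_definition scaleR_signed_measure :: "real \<Rightarrow> signed_measure \<Rightarrow> signed_measure"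
  is "\<lambda>c \<mu> A. c * \<mu> A"
  by (auto intro: sums_mult)

instance
  by standard (transfer; simp add: algebra_simps fun_eq_iff)+

end

text \<open>
  The signed measure underlying a finite Borel measure; the junk value 0 is never used for
  probability measures on the Borel sets.
\<close>

lift_definition signed_of :: "real measure \<Rightarrow> signed_measure"
  is "\<lambda>M A. if finite_measure M \<and> sets M = sets borel then measure M A else 0"
proof -
  fix M :: "real measure"
  show "?thesis M"
  proof (cases "finite_measure M \<and> sets M = sets borel")
    case True
    then interpret finite_measure M by simp
    from True show ?thesis
      using finite_measure_UNION by (simp add: measure_notin_sets)
  next
    case False
    then show ?thesis by (simp only: if_False) simp
  qed
qed

lemma sm_apply_signed_of:
  assumes "finite_measure M" "sets M = sets borel"
  shows "sm_apply (signed_of M) = measure M"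
  using assms by (simp add: signed_of.rep_eq fun_eq_iff)

lemma sm_apply_sum: "sm_apply (\<Sum>i\<in>I. f i) A = (\<Sum>i\<in>I. sm_apply (f i) A)"
  by (induction I rule: infinite_finite_induct)
     (auto simp: zero_signed_measure.rep_eq plus_signed_measure.rep_eq)


section \<open>Linear independence of families\<close>

text \<open>
  \<open>independent\<close> is a property of sets; injectivity is what makes it a property of the
  family (a family with a repeated member is dependent).
\<close>

definition independent_family :: "('i \<Rightarrow> 'v :: real_vector) \<Rightarrow> 'i set \<Rightarrow> bool" where
  "independent_family f I \<longleftrightarrow> inj_on f I \<and> independent (f ` I)"

lemma independent_family_iff:
  assumes "finite I"
  shows "independent_family f I \<longleftrightarrow>
    (\<forall>c. (\<Sum>i\<in>I. c i *\<^sub>R f i) = 0 \<longrightarrow> (\<forall>i\<in>I. c i = 0))"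
proof
  assume L: "independent_family f I"
  show "\<forall>c. (\<Sum>i\<in>I. c i *\<^sub>R f i) = 0 \<longrightarrow> (\<forall>i\<in>I. c i = 0)"
  proof (intro allI impI ballI)
    fix c i assume s: "(\<Sum>i\<in>I. c i *\<^sub>R f i) = 0" and i: "i \<in> I"
    have inj: "inj_on f I" and ind: "independent (f ` I)"
      using L by (auto simp: independent_family_def)
    have "(\<Sum>v\<in>f ` I. c (inv_into I f v) *\<^sub>R v) =
        (\<Sum>i\<in>I. c (inv_into I f (f i)) *\<^sub>R f i)"
      using sum.reindex[OF inj, of "\<lambda>v. c (inv_into I f v) *\<^sub>R v"] by (simp only: o_def)
    also have "\<dots> = (\<Sum>i\<in>I. c i *\<^sub>R f i)"
      by (rule sum.cong) (simp_all add: inv_into_f_f[OF inj])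
    finally have "(\<Sum>v\<in>f ` I. c (inv_into I f v) *\<^sub>R v) = 0" using s by (simp only:)
    from independentD[OF ind _ subset_refl this, of "f i"] assms i
    have "c (inv_into I f (f i)) = 0" by blast
    thus "c i = 0" by (simp only: inv_into_f_f[OF inj i])
  qed
next
  assume R: "\<forall>c. (\<Sum>i\<in>I. c i *\<^sub>R f i) = 0 \<longrightarrow> (\<forall>i\<in>I. c i = 0)"
  have inj: "inj_on f I"
  proof (rule inj_onI, rule ccontr)
    fix i k assume ik: "i \<in> I" "k \<in> I" "f i = f k" "i \<noteq> k"
    define c :: "'a \<Rightarrow> real" where "c = (\<lambda>x. if x = i then 1 else if x = k then - 1 else 0)"
    have "(\<Sum>x\<in>I. c x *\<^sub>R f x) = (\<Sum>x\<in>{i, k}. c x *\<^sub>R f x)"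
      using assms ik by (intro sum.mono_neutral_right) (auto simp: c_def)
    also have "\<dots> = 0" using ik by (simp add: c_def)
    finally have "c i = 0" using R ik by blast
    thus False by (simp add: c_def)
  qed
  moreover have "independent (f ` I)"
  proof
    assume "dependent (f ` I)"
    then obtain u v where uv: "v \<in> f ` I" "u v \<noteq> 0" "(\<Sum>v\<in>f ` I. u v *\<^sub>R v) = 0"
      using assms by (auto simp: dependent_finite)
    have "(\<Sum>i\<in>I. u (f i) *\<^sub>R f i) = 0"
      using uv(3) sum.reindex[OF inj, of "\<lambda>v. u v *\<^sub>R v"] by (simp only: o_def)
    hence "\<forall>i\<in>I. u (f i) = 0" using R[rule_format, of "\<lambda>i. u (f i)"] by blast
    thus False using uv by auto
  qed
  ultimately show "independent_family f I" by (simp add: independent_family_def)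
qed


section \<open>Mixtures of product measures\<close>

text \<open>
  The space \<open>\<real>\<^sup>p\<close> with its Borel sets is \<open>Pi\<^sub>M {1..p} (\<lambda>_. borel)\<close>;
  \<open>real_distribution\<close> is the library's locale of Borel probability measures on the reals.
\<close>

definition product_mixture ::
  "nat \<Rightarrow> nat \<Rightarrow> (nat \<Rightarrow> real) measure \<Rightarrow> (nat \<Rightarrow> real) \<Rightarrow> (nat \<Rightarrow> nat \<Rightarrow> real measure) \<Rightarrow> bool"
where
  "product_mixture r p P \<pi> \<mu> \<longleftrightarrow>
     (\<forall>i\<in>{1..r}. \<pi> i > 0) \<and> (\<Sum>i=1..r. \<pi> i) = 1 \<and>
     (\<forall>i\<in>{1..r}. \<forall>j\<in>{1..p}. real_distribution (\<mu> i j)) \<and>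
     (\<forall>A\<in>sets P. measure P A = (\<Sum>i=1..r. \<pi> i * measure (Pi\<^sub>M {1..p} (\<mu> i)) A))"

end

theory Submission
  imports Defs
begin

text \<open>
  The proof contracts one coordinate with linear functionals and compares coefficients in the
  others. Write \<open>f i\<close>, \<open>g i\<close>, \<open>h i\<close> for the signed measures
  of the components of the first mixture at three distinct coordinates \<open>a\<close>,
  \<open>b\<close>, \<open>c\<close>, and \<open>f' k\<close>, \<open>g' k\<close>,
  \<open>h' k\<close> for those of the second. Evaluating both mixtures on boxes gives
  \[ \sum_i \pi_i\, f_i(X)\, g_i(Y)\, h_i(Z) = \sum_k \pi'_k\, f'_k(X)\, g'_k(Y)\, h'_k(Z). \]
  As the \<open>f i\<close> are independent, there is a linear functional \<open>\<phi>\<close> on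
  signed measures that is 1 on \<open>f m\<close> and 0 on the other \<open>f i\<close>. Applied in
  the variable \<open>X\<close>, it leaves
  \[ \pi_m\, h_m(Z)\, g_m = \sum_k \pi'_k\, \phi(f'_k)\, h'_k(Z)\, g'_k. \]
  For \<open>Z = UNIV\<close> this puts each \<open>g m\<close> into the span of the
  \<open>g' k\<close>, so the \<open>g' k\<close>, being as many as the independent
  \<open>g m\<close>, are independent too. Subtracting \<open>h m Z\<close> times the instance
  \<open>Z = UNIV\<close> and comparing coefficients of \<open>g' k\<close> gives
  \<open>\<phi> (f' k) = 0\<close> or \<open>h' k = h m\<close>; and \<open>\<phi> (f' k)\<close>
  cannot vanish for all \<open>k\<close>, since \<open>g m \<noteq> 0\<close>.

  A label \<open>k\<close> with \<open>\<phi> (f' k) \<noteq> 0\<close> is chosen from coordinate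
  \<open>a\<close> alone, hence component \<open>k\<close> of the second mixture agrees with
  component \<open>m\<close> of the first at every coordinate other than \<open>a\<close>
  (\<open>components_match_off_coordinate\<close>). Since \<open>p \<ge> 3\<close>, the matchings
  obtained from \<open>a = 1\<close> and \<open>a = 2\<close> can be compared at coordinate 3, where
  independence forces them to coincide. The weights then follow from independence at a single
  coordinate.
\<close>

section \<open>Independent families\<close>

text \<open>
  A Steinitz exchange count: a family indexed by \<open>I\<close> that repeats a member or satisfies
  a linear relation spans a space of dimension less than \<open>card I\<close>.
\<close>

lemma independent_family_if_spans_independent_family:
  fixes g :: "'i \<Rightarrow> 'v :: real_vector"
  assumes I: "finite I" and g: "independent_family g I"
    and span: "\<And>i. i \<in> I \<Longrightarrow> g i \<in> span (g' ` I)"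
  shows "independent_family g' I"
proof -
  have bound: "card I \<le> card T" if "finite T" "g ` I \<subseteq> span T" for T
    using independent_span_bound[of T "g ` I"] that g
    by (simp add: independent_family_def card_image)
  have sub: "g ` I \<subseteq> span (g' ` I)"
    using span by auto
  have card: "card (g' ` I) = card I"
    using bound[OF _ sub] card_image_le[OF I, of g'] I by simp
  moreover have "independent (g' ` I)"
  proof
    assume "dependent (g' ` I)"
    then obtain v where v: "v \<in> g' ` I" "v \<in> span (g' ` I - {v})"
      by (auto simp: dependent_def)
    have "span (g' ` I) = span (g' ` I - {v})"
      using span_redundant[OF v(2)] v(1) by (simp add: insert_absorb)
    then have "card I \<le> card (g' ` I - {v})"
      using sub I by (intro bound) auto
    also have "\<dots> < card (g' ` I)"
      using v(1) I by (intro card_Diff1_less) auto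
    finally show False
      using card by simp
  qed
  ultimately show ?thesis
    using I by (simp add: independent_family_def eq_card_imp_inj_on)
qed

lemma independent_family_dual_functional:
  fixes f :: "'i \<Rightarrow> 'v :: real_vector"
  assumes "independent_family f I" and "m \<in> I"
  obtains \<phi> :: "'v \<Rightarrow> real"
  where "linear \<phi>" and "\<And>i. i \<in> I \<Longrightarrow> \<phi> (f i) = (if i = m then 1 else 0)"
proof -
  have inj: "inj_on f I" and ind: "independent (f ` I)"
    using assms(1) by (auto simp: independent_family_def)
  obtain \<phi> :: "'v \<Rightarrow> real" where "linear \<phi>"
    and "\<forall>x\<in>f ` I. \<phi> x = (if x = f m then 1 else 0)"
    using linear_independent_extend[OF ind, of "\<lambda>x. if x = f m then 1 else 0"] by blast
  with inj assms(2) that show thesis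
    by (metis (no_types, lifting) imageI inj_onD)
qed

lemma independent_family_coeff_eq:
  assumes "finite I" and "independent_family f I" and "i \<in> I"
    and "(\<Sum>i\<in>I. a i *\<^sub>R f i) = (\<Sum>i\<in>I. b i *\<^sub>R f i)"
  shows "a i = b i"
proof -
  have "(\<Sum>i\<in>I. (a i - b i) *\<^sub>R f i) = 0"
    using assms(4) by (simp add: scaleR_left_diff_distrib sum_subtractf)
  then have "a i - b i = 0"
    using assms(1-3) independent_family_iff by fast
  then show ?thesis by simp
qed

section \<open>Trilinear decompositions\<close>

lemma signed_measure_eqI:
  assumes "\<And>A. sm_apply x A = sm_apply y A"
  shows "x = y"
  using assms sm_apply_inject by (metis ext)

lemma sm_apply_linear_combination:
  "sm_apply (\<Sum>i\<in>I. c i *\<^sub>R f i) A = (\<Sum>i\<in>I. c i * sm_apply (f i) A)"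
  by (simp add: sm_apply_sum scaleR_signed_measure.rep_eq)

text \<open>
  The algebraic core. Contraction by dual functionals writes every \<open>g m\<close> as a combination
  of the \<open>g' k\<close>, which makes the latter independent and lets their coefficients be
  compared. The label \<open>k\<close> is selected by \<open>\<phi> (f' k) \<noteq> 0\<close>,
  a condition that involves neither \<open>g\<close> nor \<open>h\<close>; this is what allows one
  label to serve all coordinates in the role of \<open>h\<close>.
\<close>

lemma trilinear_decomposition_match:
  fixes f f' g g' h h' :: "'i \<Rightarrow> signed_measure"
  assumes I: "finite I"
    and g: "independent_family g I"
    and f: "independent_family f I"
    and w: "\<And>i. i \<in> I \<Longrightarrow> w i \<noteq> 0" "\<And>k. k \<in> I \<Longrightarrow> w' k \<noteq> 0"
    and h: "\<And>i. i \<in> I \<Longrightarrow> sm_apply (h i) UNIV = 1" "\<And>k. k \<in> I \<Longrightarrow> sm_apply (h' k) UNIV = 1"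
    and eq: "\<And>X Y Z.
      (\<Sum>i\<in>I. w i * sm_apply (f i) X * sm_apply (g i) Y * sm_apply (h i) Z) =
      (\<Sum>k\<in>I. w' k * sm_apply (f' k) X * sm_apply (g' k) Y * sm_apply (h' k) Z)"
    and m: "m \<in> I"
    and \<phi>: "linear \<phi>" "\<And>i. i \<in> I \<Longrightarrow> \<phi> (f i) = (if i = m then 1 else 0 :: real)"
  shows "\<exists>k\<in>I. \<phi> (f' k) \<noteq> 0"
    and "k \<in> I \<Longrightarrow> \<phi> (f' k) \<noteq> 0 \<Longrightarrow> h' k = h m"
proof -
  have contract: "(w n * sm_apply (h n) Z) *\<^sub>R g n =
      (\<Sum>k\<in>I. (w' k * \<psi> (f' k) * sm_apply (h' k) Z) *\<^sub>R g' k)"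
    if n: "n \<in> I" and \<psi>: "linear \<psi>" "\<And>i. i \<in> I \<Longrightarrow> \<psi> (f i) = (if i = n then 1 else 0 :: real)"
    for n \<psi> Z
  proof (rule signed_measure_eqI)
    fix Y
    have "(\<Sum>i\<in>I. (w i * sm_apply (g i) Y * sm_apply (h i) Z) *\<^sub>R f i) =
        (\<Sum>k\<in>I. (w' k * sm_apply (g' k) Y * sm_apply (h' k) Z) *\<^sub>R f' k)"
      using eq[of _ Y Z] by (intro signed_measure_eqI) (simp add: sm_apply_linear_combination mult_ac)
    then have "\<psi> (\<Sum>i\<in>I. (w i * sm_apply (g i) Y * sm_apply (h i) Z) *\<^sub>R f i) =
        \<psi> (\<Sum>k\<in>I. (w' k * sm_apply (g' k) Y * sm_apply (h' k) Z) *\<^sub>R f' k)"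
      by simp
    then have "(\<Sum>i\<in>I. w i * sm_apply (g i) Y * sm_apply (h i) Z * \<psi> (f i)) =
        (\<Sum>k\<in>I. w' k * sm_apply (g' k) Y * sm_apply (h' k) Z * \<psi> (f' k))"
      by (simp add: linear_sum[OF \<psi>(1)] linear_scale[OF \<psi>(1)])
    moreover have "(\<Sum>i\<in>I. w i * sm_apply (g i) Y * sm_apply (h i) Z * \<psi> (f i)) =
        (\<Sum>i\<in>I. if i = n then w i * sm_apply (g i) Y * sm_apply (h i) Z else 0)"
      by (rule sum.cong) (simp_all add: \<psi>(2))
    ultimately show "sm_apply ((w n * sm_apply (h n) Z) *\<^sub>R g n) Y =
        sm_apply (\<Sum>k\<in>I. (w' k * \<psi> (f' k) * sm_apply (h' k) Z) *\<^sub>R g' k) Y"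
      using I n by (simp add: sm_apply_linear_combination scaleR_signed_measure.rep_eq mult_ac)
  qed
  have contract_UNIV: "w n *\<^sub>R g n = (\<Sum>k\<in>I. (w' k * \<psi> (f' k)) *\<^sub>R g' k)"
    if "n \<in> I" "linear \<psi>" "\<And>i. i \<in> I \<Longrightarrow> \<psi> (f i) = (if i = n then 1 else 0 :: real)" for n \<psi>
    using contract[OF that, of UNIV] that(1) by (simp add: h cong: sum.cong)

  have g': "independent_family g' I"
  proof (rule independent_family_if_spans_independent_family[OF I g])
    fix n assume n: "n \<in> I"
    then obtain \<psi> where "linear \<psi>" "\<And>i. i \<in> I \<Longrightarrow> \<psi> (f i) = (if i = n then 1 else 0 :: real)"
      using independent_family_dual_functional[OF f n] by blast
    from contract_UNIV[OF n this] have "w n *\<^sub>R g n \<in> span (g' ` I)"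
      by (simp add: span_sum span_scale span_base)
    then have "inverse (w n) *\<^sub>R w n *\<^sub>R g n \<in> span (g' ` I)"
      by (rule span_scale)
    then show "g n \<in> span (g' ` I)"
      using w(1)[OF n] by simp
  qed

  have "g m \<noteq> 0"
    using g m by (metis dependent_zero imageI independent_family_def)
  then show "\<exists>k\<in>I. \<phi> (f' k) \<noteq> 0"
    using contract_UNIV[OF m \<phi>] w(1)[OF m] by (auto intro: ccontr)

  assume k: "k \<in> I" "\<phi> (f' k) \<noteq> 0"
  show "h' k = h m"
  proof (rule signed_measure_eqI)
    fix Z
    have "(\<Sum>k\<in>I. (w' k * \<phi> (f' k) * sm_apply (h' k) Z) *\<^sub>R g' k) = sm_apply (h m) Z *\<^sub>R w m *\<^sub>R g m"
      using contract[OF m \<phi>, of Z] by (simp add: mult.commute)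
    also have "\<dots> = (\<Sum>k\<in>I. (sm_apply (h m) Z * (w' k * \<phi> (f' k))) *\<^sub>R g' k)"
      by (simp add: contract_UNIV[OF m \<phi>] scaleR_sum_right)
    finally have "w' k * \<phi> (f' k) * sm_apply (h' k) Z = sm_apply (h m) Z * (w' k * \<phi> (f' k))"
      by (rule independent_family_coeff_eq[OF I g' k(1)])
    then show "sm_apply (h' k) Z = sm_apply (h m) Z"
      using k w(2) by simp
  qed
qed

section \<open>Mixtures evaluated on boxes\<close>

lemma measure_PiM_box:
  assumes J: "finite J" and M: "\<And>j. j \<in> J \<Longrightarrow> prob_space (M j)"
    and A: "\<And>j. j \<in> J \<Longrightarrow> A j \<in> sets (M j)"
  shows "measure (Pi\<^sub>M J M) (Pi\<^sub>E J A) = (\<Prod>j\<in>J. measure (M j) (A j))"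
proof -
  \<comment> \<open>Off \<open>J\<close> any probability measure will do; the locale asks for one at every index.\<close>
  define N where "N j = (if j \<in> J then M j else return (count_space UNIV) undefined)" for j
  have "prob_space (N j)" for j
    using M by (auto simp: N_def intro: prob_space_return)
  then interpret finite_product_prob_space N J
    using J by (simp add: finite_product_prob_space_def product_prob_space_def
        product_prob_space_axioms_def product_sigma_finite_def finite_product_sigma_finite_def
        finite_product_sigma_finite_axioms_def prob_space_imp_sigma_finite)
  have "Pi\<^sub>M J M = Pi\<^sub>M J N"
    by (rule PiM_cong) (simp_all add: N_def)
  moreover have "measure (Pi\<^sub>M J N) (Pi\<^sub>E J A) = (\<Prod>j\<in>J. measure (N j) (A j))"
    using A by (intro prob_times) (simp add: N_def)
  ultimately show ?thesis
    by (simp add: N_def)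
qed

lemma sm_apply_real_distribution:
  assumes "real_distribution M"
  shows "sm_apply (signed_of M) = measure M"
proof -
  interpret real_distribution M by fact
  show ?thesis
    by (rule sm_apply_signed_of) (simp_all add: finite_measure_axioms)
qed

lemma signed_of_real_distribution_eqD:
  assumes "real_distribution M" and "real_distribution N" and "signed_of M = signed_of N"
  shows "M = N"
proof -
  interpret M: real_distribution M by fact
  interpret N: real_distribution N by fact
  have "measure M = measure N"
    using assms sm_apply_real_distribution by metis
  then show ?thesis
    by (intro measure_eqI) (simp_all add: M.emeasure_eq_measure N.emeasure_eq_measure)
qed

lemma product_mixture_box:
  assumes mix: "product_mixture r p P \<pi> \<mu>"
    and P: "sets P = sets (Pi\<^sub>M {1..p} (\<lambda>_. borel))"
    and A: "\<And>j. A j \<in> sets borel"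
  shows "measure P (Pi\<^sub>E {1..p} A) =
    (\<Sum>i=1..r. \<pi> i * (\<Prod>j=1..p. sm_apply (signed_of (\<mu> i j)) (A j)))"
proof -
  have rd: "real_distribution (\<mu> i j)" if "i \<in> {1..r}" "j \<in> {1..p}" for i j
    using mix that by (auto simp: product_mixture_def)
  have "Pi\<^sub>E {1..p} A \<in> sets P"
    unfolding P using A by (intro sets_PiM_I_finite) auto
  then have "measure P (Pi\<^sub>E {1..p} A) =
      (\<Sum>i=1..r. \<pi> i * measure (Pi\<^sub>M {1..p} (\<mu> i)) (Pi\<^sub>E {1..p} A))"
    using mix by (simp add: product_mixture_def)
  also have "\<dots> = (\<Sum>i=1..r. \<pi> i * (\<Prod>j=1..p. sm_apply (signed_of (\<mu> i j)) (A j)))"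
  proof (rule sum.cong[OF refl], rule arg_cong[where f = "(*) _"])
    fix i assume i: "i \<in> {1..r}"
    have "measure (Pi\<^sub>M {1..p} (\<mu> i)) (Pi\<^sub>E {1..p} A) = (\<Prod>j=1..p. measure (\<mu> i j) (A j))"
      using rd[OF i] A
      by (intro measure_PiM_box)
         (auto simp: real_distribution_def real_distribution_axioms_def)
    also have "\<dots> = (\<Prod>j=1..p. sm_apply (signed_of (\<mu> i j)) (A j))"
      using rd[OF i] by (intro prod.cong) (simp_all add: sm_apply_real_distribution)
    finally show "measure (Pi\<^sub>M {1..p} (\<mu> i)) (Pi\<^sub>E {1..p} A) = \<dots>" .
  qed
  finally show ?thesis .
qed

lemma sm_apply_signed_of_UNIV:
  assumes "real_distribution M"
  shows "sm_apply (signed_of M) UNIV = 1"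
proof -
  interpret real_distribution M by fact
  show ?thesis
    using prob_space assms by (simp add: sm_apply_real_distribution)
qed

lemma sm_apply_not_borel: "A \<notin> sets borel \<Longrightarrow> sm_apply x A = 0"
  using sm_apply[of x] by auto

lemma product_mixture_three_marginal:
  assumes mix: "product_mixture r p P \<pi> \<mu>"
    and P: "sets P = sets (Pi\<^sub>M {1..p} (\<lambda>_. borel))"
    and abc: "a \<in> {1..p}" "b \<in> {1..p}" "c \<in> {1..p}" "a \<noteq> b" "a \<noteq> c" "b \<noteq> c"
    and XYZ: "X \<in> sets borel" "Y \<in> sets borel" "Z \<in> sets borel"
  shows "measure P (Pi\<^sub>E {1..p} ((\<lambda>_. UNIV)(a := X, b := Y, c := Z))) =
    (\<Sum>i=1..r. \<pi> i * sm_apply (signed_of (\<mu> i a)) X * sm_apply (signed_of (\<mu> i b)) Y *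
      sm_apply (signed_of (\<mu> i c)) Z)"
proof -
  let ?A = "(\<lambda>_. UNIV)(a := X, b := Y, c := Z)"
  have "(\<Prod>j=1..p. sm_apply (signed_of (\<mu> i j)) (?A j)) =
      sm_apply (signed_of (\<mu> i a)) X * sm_apply (signed_of (\<mu> i b)) Y *
      sm_apply (signed_of (\<mu> i c)) Z" if "i \<in> {1..r}" for i
  proof -
    have "real_distribution (\<mu> i j)" if "j \<in> {1..p}" for j
      using mix \<open>i \<in> {1..r}\<close> that by (auto simp: product_mixture_def)
    then have "(\<Prod>j=1..p. sm_apply (signed_of (\<mu> i j)) (?A j)) =
        (\<Prod>j\<in>{a, b, c}. sm_apply (signed_of (\<mu> i j)) (?A j))"
      using abc by (intro prod.mono_neutral_right) (auto simp: sm_apply_signed_of_UNIV)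
    also have "\<dots> = sm_apply (signed_of (\<mu> i a)) X * sm_apply (signed_of (\<mu> i b)) Y *
        sm_apply (signed_of (\<mu> i c)) Z"
      using abc by simp
    finally show ?thesis .
  qed
  moreover have "?A j \<in> sets borel" for j
    using XYZ by simp
  ultimately show ?thesis
    using product_mixture_box[OF mix P, of ?A] by (simp only: mult.assoc cong: sum.cong)
qed

section \<open>Identifiability\<close>

text \<open>
  The functional \<open>\<phi>\<close>, and with it the label \<open>\<kappa> m\<close>, is fixed before
  \<open>c\<close> varies; for each \<open>c\<close> any third coordinate \<open>b\<close> serves as the
  one whose coefficients are compared.
\<close>

lemma components_match_off_coordinate:
  assumes p: "p \<ge> 3" and P: "sets P = sets (Pi\<^sub>M {1..p} (\<lambda>_. borel))"
    and \<mu>: "product_mixture r p P \<pi> \<mu>"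
    and ind: "\<And>j. j \<in> {1..p} \<Longrightarrow> independent_family (\<lambda>i. signed_of (\<mu> i j)) {1..r}"
    and \<nu>: "product_mixture r p P \<pi>' \<nu>"
    and a: "a \<in> {1..p}"
  shows "\<exists>\<kappa>. \<forall>m\<in>{1..r}. \<kappa> m \<in> {1..r} \<and> (\<forall>c\<in>{1..p} - {a}. \<nu> (\<kappa> m) c = \<mu> m c)"
proof (rule bchoice, rule ballI)
  fix m assume m: "m \<in> {1..r}"
  have rd\<mu>: "real_distribution (\<mu> i j)" and rd\<nu>: "real_distribution (\<nu> i j)"
    if "i \<in> {1..r}" "j \<in> {1..p}" for i j
    using \<mu> \<nu> that by (auto simp: product_mixture_def)
  have w: "\<pi> i \<noteq> 0" "\<pi>' i \<noteq> 0" if "i \<in> {1..r}" for i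
    using \<mu> \<nu> that by (auto simp: product_mixture_def dest!: bspec)
  obtain \<phi> :: "signed_measure \<Rightarrow> real" where \<phi>: "linear \<phi>"
    "\<And>i. i \<in> {1..r} \<Longrightarrow> \<phi> (signed_of (\<mu> i a)) = (if i = m then 1 else 0)"
    using independent_family_dual_functional[OF ind[OF a] m] by blast
  have match: "(\<exists>k\<in>{1..r}. \<phi> (signed_of (\<nu> k a)) \<noteq> 0) \<and>
      (\<forall>k\<in>{1..r}. \<phi> (signed_of (\<nu> k a)) \<noteq> 0 \<longrightarrow> signed_of (\<nu> k c) = signed_of (\<mu> m c))"
    if c: "c \<in> {1..p}" "c \<noteq> a" for c
  proof -
    have "card {a, c} < card {1..p}"
      using p card_insert_le_m1[of 2 "{c}" a] by simp
    then have "\<not> {1..p} \<subseteq> {a, c}"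
      by (meson card_mono finite.emptyI finite_insert leD)
    then obtain b where b: "b \<in> {1..p}" "b \<noteq> a" "b \<noteq> c"
      by blast
    have eq: "(\<Sum>i=1..r. \<pi> i * sm_apply (signed_of (\<mu> i a)) X * sm_apply (signed_of (\<mu> i b)) Y *
          sm_apply (signed_of (\<mu> i c)) Z) =
        (\<Sum>k=1..r. \<pi>' k * sm_apply (signed_of (\<nu> k a)) X * sm_apply (signed_of (\<nu> k b)) Y *
          sm_apply (signed_of (\<nu> k c)) Z)" for X Y Z
    proof (cases "X \<in> sets borel \<and> Y \<in> sets borel \<and> Z \<in> sets borel")
      case True
      then show ?thesis
        using product_mixture_three_marginal[OF \<mu> P a b(1) c(1), of X Y Z]
          product_mixture_three_marginal[OF \<nu> P a b(1) c(1), of X Y Z] b c by simp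
    next
      case False
      then show ?thesis by (auto simp: sm_apply_not_borel)
    qed
    note core = trilinear_decomposition_match[where I = "{1..r}" and w = \<pi> and w' = \<pi>'
        and f = "\<lambda>i. signed_of (\<mu> i a)" and f' = "\<lambda>i. signed_of (\<nu> i a)"
        and g = "\<lambda>i. signed_of (\<mu> i b)" and g' = "\<lambda>i. signed_of (\<nu> i b)"
        and h = "\<lambda>i. signed_of (\<mu> i c)" and h' = "\<lambda>i. signed_of (\<nu> i c)",
        OF finite_atLeastAtMost ind[OF b(1)] ind[OF a] w
          sm_apply_signed_of_UNIV[OF rd\<mu>[OF _ c(1)]] sm_apply_signed_of_UNIV[OF rd\<nu>[OF _ c(1)]]
          eq m \<phi>]
    show ?thesis
      using core by blast
  qed
  have "\<exists>c. c \<in> {1..p} \<and> c \<noteq> a"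
    using p by (intro exI[of _ "if a = 1 then 2 else 1"]) auto
  then obtain k where k: "k \<in> {1..r}" "\<phi> (signed_of (\<nu> k a)) \<noteq> 0"
    using match by blast
  have "\<nu> k c = \<mu> m c" if "c \<in> {1..p} - {a}" for c
    using match[of c] k that m by (intro signed_of_real_distribution_eqD rd\<mu> rd\<nu>) auto
  then show "\<exists>k. k \<in> {1..r} \<and> (\<forall>c\<in>{1..p} - {a}. \<nu> k c = \<mu> m c)"
    using k(1) by blast
qed

theorem theorem8:
  fixes r p :: nat
    and P :: "(nat \<Rightarrow> real) measure"
    and \<pi> \<pi>' :: "nat \<Rightarrow> real"
    and \<mu> \<nu> :: "nat \<Rightarrow> nat \<Rightarrow> real measure"
  assumes "r \<ge> 1" and "p \<ge> 3"
    and "prob_space P" and "sets P = sets (Pi\<^sub>M {1..p} (\<lambda>_. borel))"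
    and "product_mixture r p P \<pi> \<mu>"
    and "\<And>j. j \<in> {1..p} \<Longrightarrow> independent_family (\<lambda>i. signed_of (\<mu> i j)) {1..r}"
    and "product_mixture r p P \<pi>' \<nu>"
  shows "\<exists>\<sigma>. \<sigma> permutes {1..r} \<and>
    (\<forall>i\<in>{1..r}. \<pi>' i = \<pi> (\<sigma> i) \<and> (\<forall>j\<in>{1..p}. \<nu> i j = \<mu> (\<sigma> i) j))"
proof -
  let ?I = "{1..r}"
  have dims: "1 \<in> {1..p}" "2 \<in> {1..p}" "3 \<in> {1..p}"
    using assms(2) by auto
  have match: "\<exists>\<kappa>. \<forall>m\<in>?I. \<kappa> m \<in> ?I \<and> (\<forall>c\<in>{1..p} - {a}. \<nu> (\<kappa> m) c = \<mu> m c)"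
    if "a \<in> {1..p}" for a
    by (rule components_match_off_coordinate[OF assms(2,4,5) _ assms(7) that]) (rule assms(6))
  from match[OF dims(1)] obtain \<kappa> where
    "\<forall>m\<in>?I. \<kappa> m \<in> ?I \<and> (\<forall>c\<in>{1..p} - {1}. \<nu> (\<kappa> m) c = \<mu> m c)" ..
  then have \<kappa>: "\<And>m. m \<in> ?I \<Longrightarrow> \<kappa> m \<in> ?I"
    "\<And>m c. m \<in> ?I \<Longrightarrow> c \<in> {1..p} - {1} \<Longrightarrow> \<nu> (\<kappa> m) c = \<mu> m c"
    by blast+
  from match[OF dims(2)] obtain \<kappa>' where
    "\<forall>m\<in>?I. \<kappa>' m \<in> ?I \<and> (\<forall>c\<in>{1..p} - {2}. \<nu> (\<kappa>' m) c = \<mu> m c)" ..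
  then have \<kappa>': "\<And>m. m \<in> ?I \<Longrightarrow> \<kappa>' m \<in> ?I"
    "\<And>m c. m \<in> ?I \<Longrightarrow> c \<in> {1..p} - {2} \<Longrightarrow> \<nu> (\<kappa>' m) c = \<mu> m c"
    by blast+
  have inj3: "m = n" if "m \<in> ?I" "n \<in> ?I" "\<mu> m 3 = \<mu> n 3" for m n
    using assms(6)[of 3] assms(2) that
    by (auto simp: independent_family_def dest!: inj_onD[where x = m and y = n])
  have "inj_on \<kappa> ?I"
  proof (rule inj_onI)
    fix m n assume mn: "m \<in> ?I" "n \<in> ?I" "\<kappa> m = \<kappa> n"
    then have "\<mu> m 3 = \<mu> n 3"
      using \<kappa>(2)[of m 3] \<kappa>(2)[of n 3] dims by simp
    then show "m = n"
      using inj3[OF mn(1,2)] by simp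
  qed
  then have bij: "bij_betw \<kappa> ?I ?I"
    using \<kappa>(1) by (simp add: bij_betw_def endo_inj_surj image_subset_iff)
  \<comment> \<open>Both matchings are valid at coordinate 3, and a component is determined by it there.\<close>
  have "\<kappa>' m = \<kappa> m" if m: "m \<in> ?I" for m
  proof -
    obtain n where n: "n \<in> ?I" "\<kappa>' m = \<kappa> n"
      using bij \<kappa>'(1)[OF m] by (metis bij_betw_imp_surj_on imageE)
    then have "\<mu> m 3 = \<mu> n 3"
      using \<kappa>(2)[of n 3] \<kappa>'(2)[of m 3] m assms(2) by simp
    then show ?thesis
      using inj3[OF m n(1)] n(2) by simp
  qed
  then have components: "\<nu> (\<kappa> m) j = \<mu> m j" if "m \<in> ?I" "j \<in> {1..p}" for m j
    using \<kappa>(2)[of m j] \<kappa>'(2)[of m j] that by (cases "j = 1") auto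

  \<comment> \<open>Compare the first marginals: both are combinations of the independent \<open>\<mu> m 1\<close>.\<close>
  have weights: "\<pi>' (\<kappa> m) = \<pi> m" if m: "m \<in> ?I" for m
  proof -
    have "(\<Sum>i\<in>?I. \<pi> i *\<^sub>R signed_of (\<mu> i 1)) = (\<Sum>k\<in>?I. \<pi>' k *\<^sub>R signed_of (\<nu> k 1))"
    proof (rule signed_measure_eqI)
      fix X
      show "sm_apply (\<Sum>i\<in>?I. \<pi> i *\<^sub>R signed_of (\<mu> i 1)) X =
          sm_apply (\<Sum>k\<in>?I. \<pi>' k *\<^sub>R signed_of (\<nu> k 1)) X"
      proof (cases "X \<in> sets borel")
        case True
        have unit: "sm_apply (signed_of (\<mu> i j)) UNIV = 1" "sm_apply (signed_of (\<nu> i j)) UNIV = 1"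
          if "i \<in> ?I" "j \<in> {1..p}" for i j
          using assms(5,7) that by (auto simp: product_mixture_def sm_apply_signed_of_UNIV)
        have "(\<Sum>i\<in>?I. \<pi> i * sm_apply (signed_of (\<mu> i 1)) X) =
            (\<Sum>i\<in>?I. \<pi> i * sm_apply (signed_of (\<mu> i 1)) X *
              sm_apply (signed_of (\<mu> i 2)) UNIV * sm_apply (signed_of (\<mu> i 3)) UNIV)"
          by (rule sum.cong) (simp_all only: unit dims mult_1_right)
        also have "\<dots> = (\<Sum>k\<in>?I. \<pi>' k * sm_apply (signed_of (\<nu> k 1)) X *
              sm_apply (signed_of (\<nu> k 2)) UNIV * sm_apply (signed_of (\<nu> k 3)) UNIV)"
          using product_mixture_three_marginal[OF assms(5,4) dims, of X UNIV UNIV]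
            product_mixture_three_marginal[OF assms(7,4) dims, of X UNIV UNIV] True by simp
        also have "\<dots> = (\<Sum>k\<in>?I. \<pi>' k * sm_apply (signed_of (\<nu> k 1)) X)"
          by (rule sum.cong) (simp_all only: unit dims mult_1_right)
        finally show ?thesis
          by (simp only: sm_apply_linear_combination)
      qed (simp add: sm_apply_not_borel)
    qed
    also have "\<dots> = (\<Sum>i\<in>?I. \<pi>' (\<kappa> i) *\<^sub>R signed_of (\<nu> (\<kappa> i) 1))"
      by (rule sum.reindex_bij_betw[OF bij, symmetric])
    also have "\<dots> = (\<Sum>i\<in>?I. \<pi>' (\<kappa> i) *\<^sub>R signed_of (\<mu> i 1))"
      using components assms(2) by (intro sum.cong) auto
    finally have "\<pi> m = \<pi>' (\<kappa> m)"
      by (rule independent_family_coeff_eq[OF finite_atLeastAtMost assms(6)[OF dims(1)] m])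
    then show ?thesis ..
  qed

  define \<sigma> where "\<sigma> k = (if k \<in> ?I then inv_into ?I \<kappa> k else k)" for k
  have "bij_betw \<sigma> ?I ?I = bij_betw (inv_into ?I \<kappa>) ?I ?I"
    by (rule bij_betw_cong) (simp only: \<sigma>_def if_True)
  then have "\<sigma> permutes ?I"
    using bij_betw_inv_into[OF bij]
    by (intro bij_imp_permutes) (simp_all only: \<sigma>_def if_False)
  moreover have "\<pi>' k = \<pi> (\<sigma> k) \<and> (\<forall>j\<in>{1..p}. \<nu> k j = \<mu> (\<sigma> k) j)" if k: "k \<in> ?I" for k
  proof -
    have "\<sigma> k = inv_into ?I \<kappa> k"
      using k by (simp only: \<sigma>_def if_True)
    then have "\<sigma> k \<in> ?I" "\<kappa> (\<sigma> k) = k"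
      using k bij_betw_imp_surj_on[OF bij] inv_into_into[of k \<kappa> ?I] f_inv_into_f[of k \<kappa> ?I]
      by (simp_all only:)
    then show ?thesis
      using components[of "\<sigma> k"] weights[of "\<sigma> k"] by simp
  qed
  ultimately show ?thesis
    by blast
qed

end
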